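(* Let $\mathcal{G}$ be a strongly connected and weight-balanced weighted digraph on $N$ nodes with Laplacian $L=[L_{ij}]$. For inputs $u^i:[0,\infty)\to\mathbb{R}$ whose derivatives satisfy $\|\Pi_N\dot u\|_{\rm ess}=\gamma<\infty$, and for any $\alpha,\beta>0$, consider the algorithm $$\dot z^i=\dot u^i-\alpha(z^i-u^i)-\beta\sum_{j=1}^N L_{ij}z^j-v^i,\qquad \dot v^i=\alpha\beta\sum_{j=1}^N L_{ij}z^j,$$ $$\dot x^i=-\theta^i(t)(x^i-z^i)+\dot u^i-\alpha(z^i-u^i)-\beta\sum_{j=1}^N L_{ij}z^j-v^i,$$ $i\in\{1,\dots,N\}$, where each $\theta^i:[0,\infty)\to\mathbb{R}$ is a time-varying gain with $0<\underline\theta^i\le\theta^i(t)\le\bar\theta^i$ for all $t\ge0$, initialized at $x^i(0),z^i(0),v^i(0)\in\mathbb{R}$ such that $\sum_{i=1}^N v^i(0)=0$. Then $$\limsup_{t\to\infty}\Big|x^i(t)-\frac1N\sum_{j=1}^N u^j(t)\Big|\le(\beta\hat\lambda_2)^{-1}\gamma,\qquad i\in\{1,\dots,N\},$$ and the rate of decay of the transient response is $\min\{\underline\theta^i,\alpha,\beta\hat\lambda_2\}$ for each agent $i\in\{1,\dots,N\}$.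
   Context: Weighted digraph $\mathcal{G}$ on nodes (agents) $\{1,\dots,N\}$: adjacency matrix $\mathsf{A}=[a_{ij}]$ with $a_{ij}>0$ if $(i,j)$ is an edge and $a_{ij}=0$ otherwise. Weight-balanced: $\sum_j a_{ij}=\sum_j a_{ji}$ for every $i$. Laplacian: $L=D^{\rm out}-\mathsf{A}$, where $D^{\rm out}$ is diagonal with entries $\sum_j a_{ij}$. $\hat\lambda_2>0$ is the smallest nonzero eigenvalue of $\frac12(L+L^\top)$. $\Pi_N=I_N-\frac1N\mathbf{1}_N\mathbf{1}_N^\top$, $u=(u^1,\dots,u^N)$, and $\|f\|_{\rm ess}$ is the (essential) supremum over $t\ge0$ of the Euclidean norm $\|f(t)\|$. "Rate of decay of the transient response" is used informally, for the exponential rate at which the tracking error of agent $i$ reaches the ultimate error neighbourhood above. *)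

theory Defs
  imports "HOL-Analysis.Analysis" "HOL-Probability.Essential_Supremum"
begin

text \<open>The nodes are the elements of a finite type \<open>'n\<close>, so \<open>N = CARD('n)\<close>; \<open>E\<close> is the set of
  directed edges.\<close>

definition adjacency_matrix :: "('n::finite \<times> 'n) set \<Rightarrow> real^'n^'n \<Rightarrow> bool" where
  "adjacency_matrix E A \<longleftrightarrow>
     (\<forall>i j. ((i, j) \<in> E \<longrightarrow> A $ i $ j > 0) \<and> ((i, j) \<notin> E \<longrightarrow> A $ i $ j = 0))"

definition strongly_connected :: "('n::finite \<times> 'n) set \<Rightarrow> bool" where
  "strongly_connected E \<longleftrightarrow> (\<forall>i j. (i, j) \<in> E\<^sup>*)"

definition weight_balanced :: "real^'n^'n \<Rightarrow> bool" where
  "weight_balanced A \<longleftrightarrow> (\<forall>i. (\<Sum>j\<in>UNIV. A $ i $ j) = (\<Sum>j\<in>UNIV. A $ j $ i))"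

definition out_degree_matrix :: "real^'n^'n \<Rightarrow> real^'n^'n" where
  "out_degree_matrix A = (\<chi> i j. if i = j then (\<Sum>k\<in>UNIV. A $ i $ k) else 0)"

definition laplacian :: "real^'n^'n \<Rightarrow> real^'n^'n" where
  "laplacian A = out_degree_matrix A - A"

definition real_eigenvalue :: "real^'n^'n \<Rightarrow> real \<Rightarrow> bool" where
  "real_eigenvalue M \<mu> \<longleftrightarrow> (\<exists>x. x \<noteq> 0 \<and> M *v x = \<mu> *s x)"

text \<open>A symmetric matrix has real spectrum, so only real eigenvalues need to be considered.
  For a single node the Laplacian is \<open>0\<close>, there is no nonzero eigenvalue, and the value is an
  unspecified real number.\<close>

definition lambda2_hat :: "real^'n^'n \<Rightarrow> real" where
  "lambda2_hat L = Min {\<mu>. \<mu> \<noteq> 0 \<and> real_eigenvalue ((1/2) *\<^sub>R (L + transpose L)) \<mu>}"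

definition averaging_projection :: "real^'n^'n" where
  "averaging_projection = mat 1 - (1 / real CARD('n)) *\<^sub>R (\<chi> i j. 1)"

definition ess_norm :: "(real \<Rightarrow> real^'n) \<Rightarrow> ereal" where
  "ess_norm f = esssup (lebesgue_on {0..}) (\<lambda>t. ereal (norm (f t)))"

text \<open>\<open>f' = df/dt\<close> on \<open>[0,\<infinity>)\<close> in the sense of Caratheodory: \<open>f\<close> is the indefinite
  (Henstock--Kurzweil) integral of \<open>f'\<close>. This covers functions differentiable at every
  \<open>t \<ge> 0\<close> (see the lemma below) as well as locally absolutely continuous functions with an
  almost everywhere derivative, as needed for discontinuous gains and inputs with kinks.\<close>

definition has_time_derivative :: "(real \<Rightarrow> real) \<Rightarrow> (real \<Rightarrow> real) \<Rightarrow> bool"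
    (infix \<open>has'_time'_derivative\<close> 50) where
  "f has_time_derivative f' \<longleftrightarrow> (\<forall>t\<ge>0. (f' has_integral (f t - f 0)) {0..t})"

lemma has_time_derivative_classical:
  assumes "\<And>t. t \<ge> 0 \<Longrightarrow> (f has_real_derivative f' t) (at t within {0..})"
  shows "f has_time_derivative f'"
  unfolding has_time_derivative_def
proof (intro allI impI)
  fix t :: real assume "t \<ge> 0"
  then show "(f' has_integral (f t - f 0)) {0..t}"
  proof (rule fundamental_theorem_of_calculus)
    fix s assume "s \<in> {0..t}"
    then show "(f has_vector_derivative f' s) (at s within {0..t})"
      using assms[of s] has_real_derivative_iff_has_vector_derivative
      by (auto intro: has_vector_derivative_within_subset)
  qed
qed

end

theory Submission
  imports Defs
begin

text \<open>Put \<open>p = \<alpha>(z - u) + v\<close>. Along the algorithm the terms in \<open>L z\<close> cancel and \<open>p' = -\<alpha> p\<close>, so \<open>p\<close>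
  decays like \<open>exp (-\<alpha> t)\<close> and the equation for \<open>z\<close> becomes \<open>z' = u' - p - \<beta> L z\<close>. With
  \<open>N\<close> the number of nodes and \<open>\<zeta> = \<Pi> z\<close> the disagreement part of \<open>z\<close>, the error of agent \<open>i\<close> splits as
  \<open>(x\<^sub>i - z\<^sub>i) + (\<Sum>z - \<Sum>u) / N + \<zeta>\<^sub>i\<close>.

  The first part satisfies \<open>y' = -\<theta>\<^sub>i y\<close> and decays at the rate of the lower bound of \<open>\<theta>\<^sub>i\<close>. Weight
  balance makes \<open>\<Sum>v\<close> constant, hence zero, so the second part is \<open>\<Sum>p / (\<alpha> N)\<close> and decays at rate
  \<open>\<alpha>\<close>. The third part satisfies \<open>\<zeta>' = \<Pi> u' - \<Pi> p - \<beta> L \<zeta>\<close>. On vectors of zero sum the quadratic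
  form of \<open>L\<close> is at least \<open>\<lambda> \<bar>\<zeta>\<bar>\<^sup>2\<close> with \<open>\<lambda>\<close> the smallest nonzero eigenvalue of the symmetric part of
  \<open>L\<close> (\<open>laplacian_coercive\<close>), so formally \<open>\<bar>\<zeta>\<bar>' \<le> -\<beta>\<lambda> \<bar>\<zeta>\<bar> + \<gamma> + P exp (-\<alpha> t)\<close>. Solving this scalar
  comparison equation gives the ultimate bound \<open>\<gamma> / (\<beta>\<lambda>)\<close>, a transient of rate \<open>min \<alpha> (\<beta>\<lambda>)\<close>, and the
  factor \<open>1 + t\<close> in the resonant case \<open>\<alpha> = \<beta>\<lambda>\<close>. If the gain bound is below the resonant rate, the
  factor is absorbed by the slower exponential.

  The trajectories are only indefinite Henstock--Kurzweil integrals, so the differential inequality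
  for the norm is not available pointwise. It is replaced by a maximum principle
  (\<open>primitive_norm_le\<close>): where the norm exceeds a candidate bound by the largest amount, the
  increment of the norm over a short interval to the left is bounded by an integral of the
  velocity against one fixed unit vector, which is a scalar integral estimate that tolerates
  null sets. All three decay estimates are instances of it.

  For a single node \<open>\<Pi> = 0\<close>, so \<open>\<gamma> = 0\<close> and \<open>\<zeta> = 0\<close>, and any positive number can stand in for
  \<open>\<beta>\<lambda>\<close> in the estimates.\<close>

section \<open>Indefinite integrals on the half-line\<close>

text \<open>The vector-valued form of \<open>has_time_derivative\<close>: the disagreement has to be estimated in
  the Euclidean norm, not componentwise.\<close>

definition primitive :: "(real \<Rightarrow> 'a::euclidean_space) \<Rightarrow> (real \<Rightarrow> 'a) \<Rightarrow> bool" where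
  "primitive w f \<longleftrightarrow> (\<forall>t\<ge>0. (f has_integral (w t - w 0)) {0..t})"

lemma primitive_componentwise:
  fixes w f :: "real \<Rightarrow> real^'n::finite"
  shows "primitive w f \<longleftrightarrow> (\<forall>i. (\<lambda>t. w t $ i) has_time_derivative (\<lambda>t. f t $ i))"
  unfolding primitive_def has_time_derivative_def has_integral_componentwise_iff[of f]
  by (auto simp: Basis_vec_def cart_eq_inner_axis inner_diff_left)

lemma has_time_derivative_iff_primitive: "w has_time_derivative f \<longleftrightarrow> primitive w f"
  by (simp add: has_time_derivative_def primitive_def)

lemma primitive_linear:
  assumes "bounded_linear T" "primitive w f"
  shows "primitive (\<lambda>t. T (w t)) (\<lambda>t. T (f t))"
  using assms(2) has_integral_linear[OF _ assms(1)]
  unfolding primitive_def linear_diff[OF bounded_linear.linear[OF assms(1)], symmetric]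
  by (auto simp: o_def)

lemma primitive_add:
  assumes "primitive w f" "primitive w' f'"
  shows "primitive (\<lambda>t. w t + w' t) (\<lambda>t. f t + f' t)"
  unfolding primitive_def
proof (intro allI impI)
  fix t :: real assume "t \<ge> 0"
  then have "((\<lambda>t. f t + f' t) has_integral (w t - w 0) + (w' t - w' 0)) {0..t}"
    using assms by (intro has_integral_add) (auto simp: primitive_def)
  then show "((\<lambda>t. f t + f' t) has_integral w t + w' t - (w 0 + w' 0)) {0..t}"
    by (simp add: algebra_simps)
qed

lemma primitive_scaleR:
  "primitive w f \<Longrightarrow> primitive (\<lambda>t. c *\<^sub>R w t) (\<lambda>t. c *\<^sub>R f t)"
  by (rule primitive_linear) (auto intro: bounded_linear_scaleR_right)

lemma primitive_diff:
  "primitive w f \<Longrightarrow> primitive w' f' \<Longrightarrow> primitive (\<lambda>t. w t - w' t) (\<lambda>t. f t - f' t)"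
  using primitive_add[of w f "\<lambda>t. (-1) *\<^sub>R w' t" "\<lambda>t. (-1) *\<^sub>R f' t"] primitive_scaleR[of w' f' "-1"]
  by simp

lemma primitive_zero_imp_const: "primitive w (\<lambda>_. 0) \<Longrightarrow> t \<ge> 0 \<Longrightarrow> w t = w 0"
  unfolding primitive_def by (metis eq_iff_diff_eq_0 has_integral_is_0 has_integral_unique)

lemma primitive_increment:
  assumes "primitive w f" "0 \<le> s" "s \<le> t"
  shows "(f has_integral (w t - w s)) {s..t}"
proof -
  have s: "(f has_integral (w s - w 0)) {0..s}" and t: "(f has_integral (w t - w 0)) {0..t}"
    using assms by (auto simp: primitive_def)
  have "f integrable_on {s..t}"
    using t assms(2,3) by (meson atLeastatMost_subset_iff has_integral_integrable
        integrable_on_subinterval order_refl)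
  moreover have "integral {0..s} f + integral {s..t} f = integral {0..t} f"
    using assms(2,3) t by (intro Henstock_Kurzweil_Integration.integral_combine) auto
  moreover have "integral {0..s} f = w s - w 0" "integral {0..t} f = w t - w 0"
    using s t by (auto intro: integral_unique)
  ultimately have "integral {s..t} f = w t - w s"
    by (metis add_diff_cancel_left' diff_diff_eq2 diff_add_cancel)
  then show ?thesis
    using \<open>f integrable_on {s..t}\<close> unfolding has_integral_iff by (auto simp: algebra_simps)
qed

lemma primitive_continuous:
  assumes "primitive w f"
  shows "continuous_on {0..} w"
proof -
  have "continuous_on {0..T} w" for T
  proof (cases "0 \<le> T")
    case True
    then have "f integrable_on {0..T}"
      using assms by (auto simp: primitive_def)
    then have "continuous_on {0..T} (\<lambda>t. w 0 + integral {0..t} f)"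
      by (intro continuous_intros indefinite_integral_continuous_1)
    moreover have "w 0 + integral {0..t} f = w t" if "t \<in> {0..T}" for t
      using assms that by (auto simp: primitive_def has_integral_iff)
    ultimately show ?thesis
      by (metis (no_types, lifting) continuous_on_cong)
  qed simp
  then have "isCont w t" if "t > 0" for t
    using that continuous_on_interior[of "{0..t+1}" w t] by (simp add: )
  moreover have "continuous (at 0 within {0..}) w"
  proof -
    have "continuous (at 0 within {0..1}) w"
      using \<open>continuous_on {0..1} w\<close> by (simp add: continuous_on_eq_continuous_within)
    moreover have "at (0::real) within {0..1} = at 0 within {0..}"
      by (rule at_within_nhd[of _ "{..<1}"]) auto
    ultimately show ?thesis by simp
  qed
  ultimately show ?thesis
    unfolding continuous_on_eq_continuous_within
    by (metis atLeast_iff continuous_at_imp_continuous_within order_le_less)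
qed

lemma primitive_tendsto_left:
  assumes "primitive w f" "s > 0"
  shows "(w \<longlongrightarrow> w s) (at_left s)"
proof -
  have "isCont w s"
    using continuous_on_interior[OF primitive_continuous[OF assms(1)], of s] assms(2) by simp
  then show ?thesis
    by (simp add: isCont_def filterlim_at_split)
qed

section \<open>Comparison of norms with scalar solutions\<close>

lemma sgn_inner_self: "sgn a \<bullet> a = norm a" for a :: "'a::real_inner"
  by (cases "a = 0") (simp_all add: sgn_div_norm power2_norm_eq_inner[symmetric] power2_eq_square)

lemma sgn_inner_le: "sgn a \<bullet> b \<le> norm b" for a :: "'a::real_inner"
  using norm_cauchy_schwarz[of "sgn a" b] by (simp add: norm_sgn split: if_splits)

text \<open>A maximum principle. If \<open>norm w - R\<close> were positive somewhere on \<open>[0, T]\<close>, it would have a positive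
  maximum at some \<open>s > 0\<close>, so to the left of \<open>s\<close> the norm would grow at least as fast as \<open>R\<close>. But
  \<open>norm (w s) - norm (w t) \<le> sgn (w s) \<bullet> (w s - w t)\<close>, and the right-hand side is the integral over
  \<open>[t, s]\<close> of the velocity in the fixed direction \<open>sgn (w s)\<close>, which \<open>drift\<close> keeps strictly below the
  growth of \<open>R\<close>. Looking to the left of \<open>s\<close> is what allows the direction to be frozen.\<close>

lemma primitive_norm_le:
  assumes w: "primitive w f" and init: "norm (w 0) \<le> R 0"
    and R: "\<And>t. t \<ge> 0 \<Longrightarrow> (R has_real_derivative R' t) (at t)"
    and X: "negligible X"
    and drift: "\<And>s. s > 0 \<Longrightarrow> R s < norm (w s) \<Longrightarrow>
        \<exists>K<R' s. \<forall>\<^sub>F \<tau> in at_left s. \<tau> \<notin> X \<longrightarrow> sgn (w s) \<bullet> f \<tau> \<le> K"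
    and T: "T \<ge> 0"
  shows "norm (w T) \<le> R T"
proof (rule ccontr)
  assume above: "\<not> norm (w T) \<le> R T"
  define d where "d t = norm (w t) - R t" for t
  have "continuous_on {0..T} R"
    using R by (meson DERIV_isCont atLeastAtMost_iff continuous_at_imp_continuous_on)
  then have "continuous_on {0..T} d"
    unfolding d_def using continuous_on_subset[OF primitive_continuous[OF w], of "{0..T}"]
    by (auto intro!: continuous_intros)
  then obtain s where s: "s \<in> {0..T}" and max: "\<And>t. t \<in> {0..T} \<Longrightarrow> d t \<le> d s"
    using continuous_attains_sup[of "{0..T}" d] T by auto
  have "d s > 0"
    using max[of T] above T by (auto simp: d_def)
  with init s have "s > 0" and ws: "R s < norm (w s)"
    by (auto simp: d_def order_less_le)
  from drift[OF this] obtain K where K: "K < R' s"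
    and dr: "\<forall>\<^sub>F \<tau> in at_left s. \<tau> \<notin> X \<longrightarrow> sgn (w s) \<bullet> f \<tau> \<le> K" by auto
  from dr obtain b where b: "b < s" "\<And>\<tau>. b < \<tau> \<Longrightarrow> \<tau> < s \<Longrightarrow> \<tau> \<notin> X \<Longrightarrow> sgn (w s) \<bullet> f \<tau> \<le> K"
    by (auto simp: eventually_at_left_field)
  have "((\<lambda>t. R t - K * t) has_real_derivative R' s - K) (at s)"
    using R[of s] \<open>s > 0\<close> by (auto intro!: derivative_eq_intros)
  from has_real_derivative_pos_inc_left[OF this] K
  obtain \<delta> where \<delta>: "\<delta> > 0" "\<And>h. 0 < h \<Longrightarrow> h < \<delta> \<Longrightarrow> R (s - h) - K * (s - h) < R s - K * s"
    by auto
  define h where "h = min (\<delta> / 2) (min s ((s - b) / 2))"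
  have h: "0 < h" "h < \<delta>" "h \<le> s" "b < s - h"
    using \<delta>(1) b(1) \<open>s > 0\<close> unfolding h_def by (auto simp: min_def field_simps)
  have "((\<lambda>\<tau>. sgn (w s) \<bullet> f \<tau>) has_integral sgn (w s) \<bullet> (w s - w (s - h))) {s - h..s}"
    using has_integral_linear[OF primitive_increment[OF w, of "s - h" s] bounded_linear_inner_right] h
    by (simp add: o_def)
  \<comment> \<open>The bound on the velocity holds off \<open>X\<close> and for \<open>\<tau> < s\<close> only; the null set is overwritten by \<open>K\<close>.\<close>
  then have "((\<lambda>\<tau>. if \<tau> \<in> insert s X then K else sgn (w s) \<bullet> f \<tau>)
      has_integral sgn (w s) \<bullet> (w s - w (s - h))) {s - h..s}"
    by (rule has_integral_spike[rotated 2, where S = "insert s X"]) (use X in auto)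
  then have "sgn (w s) \<bullet> (w s - w (s - h)) \<le> K * h"
    using has_integral_le[OF _ has_integral_const_real[of K "s - h" s]] b(2) h
    by (fastforce simp: mult.commute)
  then have "norm (w s) - norm (w (s - h)) \<le> K * h"
    using sgn_inner_self[of "w s"] sgn_inner_le[of "w s" "w (s - h)"] by (simp add: inner_diff_right)
  moreover have "d (s - h) \<le> d s"
    using max s h by auto
  ultimately show False
    using \<delta>(2)[of h] h by (simp add: d_def algebra_simps)
qed

text \<open>The velocity is the position times \<open>-\<theta>\<close>, so in the direction \<open>sgn (y s)\<close> it is about
  \<open>-\<theta> \<bar>y s\<bar>\<close> near \<open>s\<close>, and this lies below \<open>-c R s\<close> as soon as \<open>\<bar>y s\<bar> > R s\<close>.\<close>

lemma damped_norm_decay: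
  assumes y: "primitive y (\<lambda>t. - \<theta> t *\<^sub>R y t)"
    and \<theta>: "\<And>t. t \<ge> 0 \<Longrightarrow> c \<le> \<theta> t" and c: "c > 0" and t: "t \<ge> 0"
  shows "norm (y t) \<le> norm (y 0) * exp (- (c * t))"
proof (rule primitive_norm_le[OF y _ _ negligible_empty _ t])
  show "((\<lambda>t. norm (y 0) * exp (- (c * t))) has_real_derivative - c * (norm (y 0) * exp (- (c * t)))) (at t)" for t
    by (auto intro!: derivative_eq_intros)
next
  fix s :: real assume s: "s > 0" and above: "norm (y 0) * exp (- (c * s)) < norm (y s)"
  have lim: "((\<lambda>\<tau>. sgn (y s) \<bullet> y \<tau>) \<longlongrightarrow> norm (y s)) (at_left s)"
    using tendsto_inner[OF tendsto_const primitive_tendsto_left[OF y s], of "sgn (y s)"]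
    by (simp add: sgn_inner_self)
  obtain M where M: "norm (y 0) * exp (- (c * s)) < M" "M < norm (y s)"
    using dense[OF above] by blast
  \<comment> \<open>Positivity of the projection is needed to replace \<open>\<theta>\<close> by its lower bound.\<close>
  have "M > 0"
    using M(1) by (smt (verit) exp_gt_zero mult_nonneg_nonneg norm_ge_zero)
  have "\<forall>\<^sub>F \<tau> in at_left s. sgn (y s) \<bullet> y \<tau> > M"
    using order_tendstoD(1)[OF lim M(2)] .
  moreover have "\<forall>\<^sub>F \<tau> in at_left s. \<tau> > 0"
    using s by (auto simp: eventually_at_left_field intro!: exI[of _ 0])
  ultimately have "\<forall>\<^sub>F \<tau> in at_left s. sgn (y s) \<bullet> (- \<theta> \<tau> *\<^sub>R y \<tau>) \<le> - c * M"
  proof eventually_elim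
    case (elim \<tau>)
    then have "c * M \<le> \<theta> \<tau> * (sgn (y s) \<bullet> y \<tau>)"
      using \<theta>[of \<tau>] c \<open>M > 0\<close> by (intro mult_mono) auto
    then show ?case by simp
  qed
  then show "\<exists>K < - c * (norm (y 0) * exp (- (c * s))). \<forall>\<^sub>F \<tau> in at_left s. \<tau> \<notin> {} \<longrightarrow> sgn (y s) \<bullet> (- \<theta> \<tau> *\<^sub>R y \<tau>) \<le> K"
    using M(1) c by (intro exI[of _ "- c * M"]) auto
qed simp

text \<open>The comparison form of \<open>\<bar>w\<bar>' \<le> b - c \<bar>w\<bar>\<close> for \<open>w' = forcing - B w\<close>: above the graph of a solution
  of \<open>R' = b - c R\<close> the coercivity of \<open>B\<close> makes the norm grow strictly more slowly than \<open>R\<close>.\<close>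

lemma forced_norm_le:
  assumes w: "primitive w f" and B: "bounded_linear B" and X: "negligible X"
    and f: "\<And>t. t \<ge> 0 \<Longrightarrow> t \<notin> X \<Longrightarrow> norm (f t + B (w t)) \<le> b t" and b: "continuous_on UNIV b"
    and coercive: "\<And>t. t \<ge> 0 \<Longrightarrow> c * (w t \<bullet> w t) \<le> w t \<bullet> B (w t)" and c: "c > 0"
    and R: "\<And>t. (R has_real_derivative b t - c * R t) (at t)" and R0: "norm (w 0) \<le> R 0"
    and t: "t \<ge> 0"
  shows "norm (w t) \<le> R t"
proof (rule primitive_norm_le[OF w R0 R X _ t])
  fix s :: real assume s: "s > 0" and above: "R s < norm (w s)"
  let ?h = "\<lambda>\<tau>. b \<tau> - sgn (w s) \<bullet> B (w \<tau>)"
  have "(b \<longlongrightarrow> b s) (at_left s)"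
    using b by (metis UNIV_I continuous_on_def filterlim_at_split open_UNIV at_within_open)
  then have lim: "(?h \<longlongrightarrow> ?h s) (at_left s)"
    by (intro tendsto_intros bounded_linear.tendsto[OF B] primitive_tendsto_left[OF w s])
  have "c * norm (w s) \<le> sgn (w s) \<bullet> B (w s)"
  proof (cases "w s = 0")
    case False
    have "c * norm (w s) = (c * (w s \<bullet> w s)) / norm (w s)"
      using False by (simp add: power2_norm_eq_inner[symmetric] power2_eq_square)
    also have "\<dots> \<le> (w s \<bullet> B (w s)) / norm (w s)"
      using coercive[of s] s by (intro divide_right_mono) auto
    finally show ?thesis by (simp add: sgn_div_norm divide_inverse mult.commute)
  qed simp
  then have "?h s < b s - c * R s"
    using above c by (smt (verit) mult_strict_left_mono)
  then obtain K where K: "?h s < K" "K < b s - c * R s"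
    using dense by blast
  have "\<forall>\<^sub>F \<tau> in at_left s. ?h \<tau> < K"
    using order_tendstoD(2)[OF lim K(1)] .
  moreover have "\<forall>\<^sub>F \<tau> in at_left s. \<tau> > 0"
    using s by (auto simp: eventually_at_left_field intro!: exI[of _ 0])
  ultimately have "\<forall>\<^sub>F \<tau> in at_left s. \<tau> \<notin> X \<longrightarrow> sgn (w s) \<bullet> f \<tau> \<le> K"
  proof eventually_elim
    case (elim \<tau>)
    have "sgn (w s) \<bullet> f \<tau> = sgn (w s) \<bullet> (f \<tau> + B (w \<tau>)) - sgn (w s) \<bullet> B (w \<tau>)"
      by (simp add: inner_add_right)
    then show ?case
      using elim f[of \<tau>] sgn_inner_le[of "w s" "f \<tau> + B (w \<tau>)"] by auto
  qed
  with K(2) show "\<exists>K<b s - c * R s. \<forall>\<^sub>F \<tau> in at_left s. \<tau> \<notin> X \<longrightarrow> sgn (w s) \<bullet> f \<tau> \<le> K"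
    by blast
qed

text \<open>The comparison equation \<open>R' = -c R + \<gamma> + P exp (-\<alpha> t)\<close> is solved explicitly. Its forcing resonates
  with the free decay when \<open>\<alpha> = c\<close>, which produces the factor \<open>1 + t\<close>.\<close>

lemma forced_norm_transient:
  assumes w: "primitive w f" and B: "bounded_linear B" and X: "negligible X"
    and f: "\<And>t. t \<ge> 0 \<Longrightarrow> t \<notin> X \<Longrightarrow> norm (f t + B (w t)) \<le> \<gamma> + P * exp (- (\<alpha> * t))"
    and coercive: "\<And>t. t \<ge> 0 \<Longrightarrow> c * (w t \<bullet> w t) \<le> w t \<bullet> B (w t)" and c: "c > 0"
    and \<gamma>: "\<gamma> \<ge> 0" and P: "P \<ge> 0"
  shows "\<exists>C\<ge>0. \<forall>t\<ge>0. norm (w t) \<le> \<gamma> / c + C * ((if \<alpha> = c then 1 + t else 1) * exp (- (min \<alpha> c * t)))"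
proof (cases "\<alpha> = c")
  case True
  have le: "norm (w t) \<le> \<gamma> / c + (norm (w 0) + P * t) * exp (- (c * t))" if "t \<ge> 0" for t
  proof (rule forced_norm_le[OF w B X f _ coercive c _ _ that])
    show "((\<lambda>t. \<gamma> / c + (norm (w 0) + P * t) * exp (- (c * t))) has_real_derivative
        \<gamma> + P * exp (- (\<alpha> * t)) - c * (\<gamma> / c + (norm (w 0) + P * t) * exp (- (c * t)))) (at t)" for t
      using c by (auto intro!: derivative_eq_intros simp: True field_simps)
  qed (use \<gamma> c in \<open>auto intro!: continuous_intros\<close>)
  have "norm (w t) \<le> \<gamma> / c + (norm (w 0) + P) * ((1 + t) * exp (- (c * t)))" if "t \<ge> 0" for t
  proof -
    have "norm (w 0) + P * t \<le> (norm (w 0) + P) * (1 + t)"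
      using P that by (simp add: algebra_simps)
    from mult_right_mono[OF this, of "exp (- (c * t))"]
    have "(norm (w 0) + P * t) * exp (- (c * t)) \<le> (norm (w 0) + P) * ((1 + t) * exp (- (c * t)))"
      by (simp only: mult.assoc exp_ge_zero)
    with le[OF that] show ?thesis by linarith
  qed
  then show ?thesis
    using P True by (intro exI[of _ "norm (w 0) + P"]) auto
next
  case False
  \<comment> \<open>\<open>Q\<close> is the amplitude of the particular solution; \<open>K\<close> matches the initial value up to \<open>\<gamma> / c \<ge> 0\<close>.\<close>
  define Q K where "Q = P / (c - \<alpha>)" and "K = norm (w 0) - Q"
  have Q: "(c - \<alpha>) * Q = P" using False by (simp add: Q_def)
  have le: "norm (w t) \<le> \<gamma> / c + K * exp (- (c * t)) + Q * exp (- (\<alpha> * t))" if "t \<ge> 0" for t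
  proof (rule forced_norm_le[OF w B X f _ coercive c _ _ that])
    show "((\<lambda>t. \<gamma> / c + K * exp (- (c * t)) + Q * exp (- (\<alpha> * t))) has_real_derivative
        \<gamma> + P * exp (- (\<alpha> * t)) - c * (\<gamma> / c + K * exp (- (c * t)) + Q * exp (- (\<alpha> * t)))) (at t)" for t
      using c by (auto intro!: derivative_eq_intros simp: Q[symmetric] algebra_simps)
  qed (use \<gamma> c in \<open>auto intro!: continuous_intros simp: K_def\<close>)
  have "norm (w t) \<le> \<gamma> / c + (\<bar>K\<bar> + \<bar>Q\<bar>) * exp (- (min \<alpha> c * t))" if "t \<ge> 0" for t
  proof -
    have e: "exp (- (c * t)) \<le> exp (- (min \<alpha> c * t))" "exp (- (\<alpha> * t)) \<le> exp (- (min \<alpha> c * t))"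
      using that by (auto intro: mult_right_mono)
    have "K * exp (- (c * t)) \<le> \<bar>K\<bar> * exp (- (min \<alpha> c * t))" "Q * exp (- (\<alpha> * t)) \<le> \<bar>Q\<bar> * exp (- (min \<alpha> c * t))"
      using e by (auto intro: mult_mono)
    then show ?thesis
      using le[OF that] by (simp add: algebra_simps)
  qed
  then show ?thesis
    using False by (intro exI[of _ "\<bar>K\<bar> + \<bar>Q\<bar>"]) auto
qed

section \<open>Merging exponential rates\<close>

text \<open>Giving up the amount \<open>\<delta>\<close> of the exponential rate pays for a linear factor, since \<open>\<delta> t \<le> exp (\<delta> t)\<close>.\<close>

lemma affine_times_exp_le:
  fixes r \<delta> t :: real
  assumes "\<delta> > 0" "t \<ge> 0"
  shows "(1 + t) * exp (- ((r + \<delta>) * t)) \<le> (1 + 1 / \<delta>) * exp (- (r * t))"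
proof -
  have "\<delta> * t \<le> exp (\<delta> * t)"
    using exp_ge_add_one_self[of "\<delta> * t"] by linarith
  then have "t \<le> 1 / \<delta> * exp (\<delta> * t)"
    using assms(1) by (simp add: field_simps)
  moreover have "1 \<le> exp (\<delta> * t)"
    using assms by simp
  ultimately have "1 + t \<le> (1 + 1 / \<delta>) * exp (\<delta> * t)"
    unfolding distrib_right by linarith
  then have "(1 + t) * exp (- ((r + \<delta>) * t)) \<le> (1 + 1 / \<delta>) * exp (\<delta> * t) * exp (- ((r + \<delta>) * t))"
    by (intro mult_right_mono) auto
  also have "\<dots> = (1 + 1 / \<delta>) * exp (- (r * t))"
    by (simp add: mult.assoc exp_add[symmetric] algebra_simps)
  finally show ?thesis .
qed

text \<open>Three transients merge into one of the slowest rate. A resonance at \<open>\<alpha> = c\<close> is visible in the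
  sum only if \<open>\<theta>\<close> does not dominate the decay: for \<open>\<theta> < \<alpha>\<close> the margin \<open>\<alpha> - \<theta>\<close> absorbs the
  factor \<open>1 + t\<close> at the cost of the constant \<open>F\<close>.\<close>

lemma transient_rate:
  fixes \<theta> \<alpha> c :: real and err :: "real \<Rightarrow> real"
  assumes nonneg: "a \<ge> 0" "b \<ge> 0" "D \<ge> 0"
    and err: "\<And>t. t \<ge> 0 \<Longrightarrow> err t \<le> M + a * exp (- (\<theta> * t)) + b * exp (- (\<alpha> * t))
        + D * ((if \<alpha> = c then 1 + t else 1) * exp (- (min \<alpha> c * t)))"
  shows "\<exists>C\<ge>0. \<forall>t\<ge>0. err t \<le> M + C * (if \<alpha> = c \<and> \<alpha> \<le> \<theta> then 1 + t else 1) * exp (- (min \<theta> (min \<alpha> c) * t))"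
proof -
  let ?m = "min \<theta> (min \<alpha> c)"
  let ?k = "\<lambda>t. if \<alpha> = c \<and> \<alpha> \<le> \<theta> then 1 + t else 1 :: real"
  define F where "F = (if \<alpha> = c \<and> \<theta> < \<alpha> then 1 + 1 / (\<alpha> - \<theta>) else 1)"
  have "F \<ge> 0" by (auto simp: F_def)
  have slow: "exp (- (r * t)) \<le> ?k t * exp (- (?m * t))" if "t \<ge> 0" "r \<ge> ?m" for r t
  proof -
    have "exp (- (r * t)) \<le> exp (- (?m * t))"
      using that by (simp add: mult_right_mono)
    also have "\<dots> \<le> ?k t * exp (- (?m * t))"
      using that by (simp add: algebra_simps)
    finally show ?thesis .
  qed
  have res: "(if \<alpha> = c then 1 + t else 1) * exp (- (min \<alpha> c * t)) \<le> F * (?k t * exp (- (?m * t)))"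
    if "t \<ge> 0" for t
  proof (cases "\<alpha> = c \<and> \<theta> < \<alpha>")
    case True
    then show ?thesis
      using affine_times_exp_le[of "\<alpha> - \<theta>" t \<theta>] that by (simp add: F_def min_def)
  next
    case False
    then show ?thesis
      using slow[OF that, of "min \<alpha> c"] by (auto simp: F_def min_def not_less)
  qed
  have "err t \<le> M + (a + b + D * F) * ?k t * exp (- (?m * t))" if t: "t \<ge> 0" for t
  proof -
    have "a * exp (- (\<theta> * t)) \<le> a * (?k t * exp (- (?m * t)))"
      using slow[OF t, of \<theta>] nonneg by (intro mult_left_mono) auto
    moreover have "b * exp (- (\<alpha> * t)) \<le> b * (?k t * exp (- (?m * t)))"
      using slow[OF t, of \<alpha>] nonneg by (intro mult_left_mono) auto
    moreover have "D * ((if \<alpha> = c then 1 + t else 1) * exp (- (min \<alpha> c * t))) \<le> D * (F * (?k t * exp (- (?m * t))))"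
      using res[OF t] nonneg by (intro mult_left_mono) auto
    moreover have "(a + b + D * F) * ?k t * exp (- (?m * t)) = a * (?k t * exp (- (?m * t)))
        + b * (?k t * exp (- (?m * t))) + D * (F * (?k t * exp (- (?m * t))))"
      by (simp only: distrib_right mult.assoc)
    ultimately show ?thesis
      using err[OF t] by linarith
  qed
  then show ?thesis
    using nonneg \<open>F \<ge> 0\<close> by (intro exI[of _ "a + b + D * F"]) auto
qed

lemma Limsup_le_of_transient:
  fixes err :: "real \<Rightarrow> real"
  assumes "m > 0" "C \<ge> 0"
    and err: "\<And>t. t \<ge> 0 \<Longrightarrow> err t \<le> M + C * (if Q then 1 + t else 1) * exp (- (m * t))"
  shows "Limsup at_top (\<lambda>t. ereal (err t)) \<le> ereal M"
proof -
  \<comment> \<open>Half of the rate is spent on the factor \<open>1 + t\<close>, so both cases share one decaying bound.\<close>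
  let ?b = "\<lambda>t. M + C * ((1 + 1 / (m / 2)) * exp (- (m / 2 * t)))"
  have "err t \<le> ?b t" if t: "t \<ge> 0" for t
  proof -
    have "(if Q then 1 + t else 1) * exp (- (m * t)) \<le> (1 + t) * exp (- ((m / 2 + m / 2) * t))"
      using t by (auto intro: mult_right_mono)
    also have "\<dots> \<le> (1 + 1 / (m / 2)) * exp (- (m / 2 * t))"
      using assms(1) t by (intro affine_times_exp_le) auto
    finally show ?thesis
      using err[OF t] mult_left_mono[OF _ assms(2)] by (fastforce simp: mult.assoc)
  qed
  then have "\<forall>\<^sub>F t in at_top. ereal (err t) \<le> ereal (?b t)"
    by (intro eventually_mono[OF eventually_ge_at_top[of 0]]) auto
  then have "Limsup at_top (\<lambda>t. ereal (err t)) \<le> Limsup at_top (\<lambda>t. ereal (?b t))"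
    by (rule Limsup_mono)
  also have "\<dots> = ereal M"
  proof (rule lim_imp_Limsup)
    have "filterlim (\<lambda>t. - (m / 2 * t)) at_bot at_top"
      unfolding filterlim_uminus_at_bot minus_minus
      by (rule filterlim_tendsto_pos_mult_at_top[OF tendsto_const _ filterlim_ident]) (use assms(1) in simp)
    then have "((\<lambda>t. exp (- (m / 2 * t))) \<longlongrightarrow> 0) at_top"
      by (rule filterlim_compose[OF exp_at_bot])
    then have "(?b \<longlongrightarrow> M + C * ((1 + 1 / (m / 2)) * 0)) at_top"
      by (intro tendsto_intros)
    then show "((\<lambda>t. ereal (?b t)) \<longlongrightarrow> ereal M) at_top"
      by simp
  qed simp
  finally show ?thesis .
qed

section \<open>Coercivity of the Laplacian of a balanced digraph\<close>

lemma symmetric_matrix_self_adjoint: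
  fixes S :: "real^'n::finite^'n"
  assumes "transpose S = S"
  shows "x \<bullet> (S *v y) = (S *v x) \<bullet> y"
  using dot_lmul_matrix[of x "transpose S" y] unfolding vector_transpose_matrix unfolding assms by simp

text \<open>Eigenvectors for distinct eigenvalues are orthogonal, hence independent. Finiteness is needed
  because the \<open>Min\<close> of an infinite set carries no information.\<close>

lemma finite_real_eigenvalues_symmetric:
  fixes S :: "real^'n::finite^'n"
  assumes sym: "transpose S = S"
  shows "finite {\<mu>. real_eigenvalue S \<mu>}"
proof -
  note self_adj = symmetric_matrix_self_adjoint[OF sym]
  define e where "e \<mu> = (SOME x. x \<noteq> 0 \<and> S *v x = \<mu> *s x)" for \<mu>
  have e: "e \<mu> \<noteq> 0" "S *v e \<mu> = \<mu> *\<^sub>R e \<mu>" if "real_eigenvalue S \<mu>" for \<mu>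
    using someI_ex[OF that[unfolded real_eigenvalue_def]]
    unfolding e_def[symmetric] by (simp_all add: scalar_mult_eq_scaleR)
  have orth: "e \<mu> \<bullet> e \<nu> = 0" if "real_eigenvalue S \<mu>" "real_eigenvalue S \<nu>" "\<mu> \<noteq> \<nu>" for \<mu> \<nu>
    using self_adj[of "e \<mu>" "e \<nu>"] e that by auto
  have "inj_on e {\<mu>. real_eigenvalue S \<mu>}"
    using orth e by (intro inj_onI) (metis inner_eq_zero_iff mem_Collect_eq)
  moreover have "independent (e ` {\<mu>. real_eigenvalue S \<mu>})"
    using e(1) orth by (intro pairwise_orthogonal_independent) (auto simp: pairwise_def orthogonal_def)
  ultimately show ?thesis
    using finite_imageD independent_imp_finite by blast
qed

text \<open>The minimum \<open>\<mu>\<close> of the Rayleigh quotient over the compact unit sphere of \<open>V\<close> is attained at some \<open>e\<close>.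
  The form \<open>x \<bullet> S x - \<mu> x \<bullet> x\<close> is nonnegative on \<open>V\<close> and vanishes at \<open>e\<close>, so its first variation at
  \<open>e\<close> vanishes along every direction in \<open>V\<close>. By invariance of \<open>V\<close> the residual \<open>S e - \<mu> e\<close> is itself
  such a direction, hence orthogonal to itself.\<close>

lemma rayleigh_minimum_eigenvector:
  fixes S :: "real^'n::finite^'n"
  assumes sym: "transpose S = S" and V: "subspace V" and inv: "\<And>x. x \<in> V \<Longrightarrow> S *v x \<in> V"
    and nontriv: "\<exists>x\<in>V. x \<noteq> 0"
  obtains \<mu> e where "e \<in> V" "e \<noteq> 0" "S *v e = \<mu> *\<^sub>R e" "\<And>x. x \<in> V \<Longrightarrow> \<mu> * (x \<bullet> x) \<le> x \<bullet> (S *v x)"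
proof -
  have self_adj: "x \<bullet> (S *v y) = y \<bullet> (S *v x)" for x y
    using symmetric_matrix_self_adjoint[OF sym, of x y] by (simp only: inner_commute)
  let ?K = "V \<inter> sphere 0 1"
  obtain x0 where x0: "x0 \<in> V" "x0 \<noteq> 0" using nontriv by auto
  then have "sgn x0 \<in> ?K"
    using V by (auto simp: sgn_div_norm subspace_mul norm_sgn[unfolded sgn_div_norm])
  moreover have "compact ?K"
    using closed_subspace[OF V] by (simp add: closed_Int_compact)
  moreover have "continuous_on ?K (\<lambda>x. x \<bullet> (S *v x))"
    by (intro continuous_intros linear_continuous_on matrix_vector_mul_bounded_linear)
  ultimately obtain e where e: "e \<in> ?K" and min: "\<And>x. x \<in> ?K \<Longrightarrow> e \<bullet> (S *v e) \<le> x \<bullet> (S *v x)"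
    using continuous_attains_inf[of ?K] by blast
  define \<mu> where "\<mu> = e \<bullet> (S *v e)"
  have ee: "e \<bullet> e = 1"
    using e by (simp add: norm_eq_1)
  have low: "\<mu> * (x \<bullet> x) \<le> x \<bullet> (S *v x)" if "x \<in> V" for x
  proof (cases "x = 0")
    case False
    have "\<mu> \<le> sgn x \<bullet> (S *v sgn x)"
      unfolding \<mu>_def using min[of "sgn x"] that False V
      by (auto simp: sgn_div_norm subspace_mul norm_sgn[unfolded sgn_div_norm])
    also have "\<dots> = (x \<bullet> (S *v x)) / (x \<bullet> x)"
      unfolding power2_norm_eq_inner[symmetric]
      by (simp add: sgn_div_norm matrix_vector_mult_scaleR power2_eq_square field_simps)
    finally show ?thesis
      using False by (simp add: field_simps)
  qed simp
  define w where "w = S *v e - \<mu> *\<^sub>R e"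
  have wV: "w \<in> V"
    unfolding w_def using e V inv by (auto intro: subspace_diff subspace_mul)
  have quad: "0 \<le> 2 * s * (w \<bullet> w) + s\<^sup>2 * (w \<bullet> (S *v w) - \<mu> * (w \<bullet> w))" for s :: real
  proof -
    have "e + s *\<^sub>R w \<in> V"
      using e wV V by (auto intro: subspace_add subspace_mul)
    from low[OF this] have "0 \<le> 2 * s * (w \<bullet> (S *v e) - \<mu> * (w \<bullet> e)) + s\<^sup>2 * (w \<bullet> (S *v w) - \<mu> * (w \<bullet> w))"
      using self_adj[of e w] ee
      by (simp add: matrix_vector_right_distrib matrix_vector_mult_scaleR inner_simps \<mu>_def[symmetric]
          inner_commute[of e w] power2_eq_square algebra_simps)
    moreover have "w \<bullet> (S *v e) - \<mu> * (w \<bullet> e) = w \<bullet> w"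
      by (simp add: w_def inner_simps)
    ultimately show ?thesis by simp
  qed
  have "w \<bullet> w = 0"
  proof (rule ccontr)
    assume "w \<bullet> w \<noteq> 0"
    then have ww: "w \<bullet> w > 0" by (simp add: less_le)
    \<comment> \<open>A small negative multiple of \<open>w\<close> makes the linear term win; \<open>q\<close> bounds the quadratic coefficient.\<close>
    define q where "q = \<bar>w \<bullet> (S *v w) - \<mu> * (w \<bullet> w)\<bar> + 1"
    have q: "q > 0" "w \<bullet> (S *v w) - \<mu> * (w \<bullet> w) \<le> q" unfolding q_def by auto
    have "0 \<le> 2 * (- (w \<bullet> w) / q) * (w \<bullet> w) + (- (w \<bullet> w) / q)\<^sup>2 * q"
      using quad[of "- (w \<bullet> w) / q"] mult_left_mono[OF q(2) zero_le_power2, of "- (w \<bullet> w) / q"] by linarith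
    also have "\<dots> = - ((w \<bullet> w)\<^sup>2 / q)"
      using q(1) by (simp add: power2_eq_square field_simps)
    finally show False using ww q(1) by (smt (verit) divide_pos_pos zero_less_power)
  qed
  then have "S *v e = \<mu> *\<^sub>R e" by (simp add: w_def)
  moreover have "e \<noteq> 0" using ee by auto
  ultimately show thesis using that e low by blast
qed

lemma averaging_projection_component:
  fixes w :: "real^'n::finite"
  shows "(averaging_projection *v w) $ i = w $ i - (\<Sum>j\<in>UNIV. w $ j) / real CARD('n)"
  unfolding averaging_projection_def
  by (simp add: matrix_vector_mult_diff_rdistrib scaleR_matrix_vector_assoc[symmetric])
     (simp add: matrix_vector_mult_def)

lemma laplacian_mult_component:
  fixes A :: "real^'n::finite^'n"
  shows "(laplacian A *v w) $ i = (\<Sum>j\<in>UNIV. A $ i $ j * (w $ i - w $ j))"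
proof -
  have "(out_degree_matrix A *v w) $ i = (\<Sum>k\<in>UNIV. A $ i $ k) * w $ i"
    by (simp add: out_degree_matrix_def matrix_vector_mult_def if_distrib[of "\<lambda>x. x * _"] cong: if_cong)
  then show ?thesis
    by (simp add: laplacian_def matrix_vector_mult_diff_rdistrib)
       (simp add: matrix_vector_mult_def sum_distrib_right right_diff_distrib sum_subtractf)
qed

text \<open>Each column sum equals the corresponding row sum, so a node function may be summed over edges
  by head or by tail.\<close>

lemma weight_balanced_sum_swap:
  fixes A :: "real^'n::finite^'n"
  assumes "weight_balanced A"
  shows "(\<Sum>i\<in>UNIV. \<Sum>j\<in>UNIV. A $ i $ j * f j) = (\<Sum>i\<in>UNIV. \<Sum>j\<in>UNIV. A $ i $ j * (f i :: real))"
proof -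
  have "(\<Sum>i\<in>UNIV. \<Sum>j\<in>UNIV. A $ i $ j * f j) = (\<Sum>j\<in>UNIV. (\<Sum>i\<in>UNIV. A $ i $ j) * f j)"
    by (subst sum.swap) (simp add: sum_distrib_right)
  also have "\<dots> = (\<Sum>j\<in>UNIV. (\<Sum>i\<in>UNIV. A $ j $ i) * f j)"
    using assms by (simp add: weight_balanced_def)
  finally show ?thesis by (simp add: sum_distrib_right)
qed

lemma sum_laplacian_mult:
  fixes A :: "real^'n::finite^'n"
  assumes "weight_balanced A"
  shows "(\<Sum>i\<in>UNIV. (laplacian A *v w) $ i) = 0"
  using weight_balanced_sum_swap[OF assms, of "\<lambda>j. w $ j"]
  by (simp add: laplacian_mult_component right_diff_distrib sum_subtractf)

lemma laplacian_quadratic_form: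
  fixes A :: "real^'n::finite^'n"
  assumes "weight_balanced A"
  shows "w \<bullet> (laplacian A *v w) = (\<Sum>i\<in>UNIV. \<Sum>j\<in>UNIV. A $ i $ j * (w $ i - w $ j)\<^sup>2) / 2"
proof -
  have "(\<Sum>i\<in>UNIV. \<Sum>j\<in>UNIV. A $ i $ j * (w $ i - w $ j)\<^sup>2)
      = (\<Sum>i\<in>UNIV. \<Sum>j\<in>UNIV. A $ i $ j * (w $ i)\<^sup>2) + (\<Sum>i\<in>UNIV. \<Sum>j\<in>UNIV. A $ i $ j * (w $ j)\<^sup>2)
        - 2 * (\<Sum>i\<in>UNIV. \<Sum>j\<in>UNIV. A $ i $ j * (w $ i * w $ j))"
    by (simp add: power2_diff algebra_simps sum.distrib sum_subtractf sum_distrib_left)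
  also have "\<dots> = 2 * (\<Sum>i\<in>UNIV. \<Sum>j\<in>UNIV. w $ i * (A $ i $ j * (w $ i - w $ j)))"
    unfolding weight_balanced_sum_swap[OF assms, of "\<lambda>j. (w $ j)\<^sup>2"]
    by (simp add: power2_eq_square algebra_simps sum_subtractf)
  also have "(\<Sum>i\<in>UNIV. \<Sum>j\<in>UNIV. w $ i * (A $ i $ j * (w $ i - w $ j))) = w \<bullet> (laplacian A *v w)"
    by (simp only: inner_vec_def laplacian_mult_component sum_distrib_left inner_real_def)
  finally show ?thesis by simp
qed

text \<open>A vanishing sum of nonnegative terms forces \<open>w\<close> to agree along each edge, and the edges
  connect every pair of nodes.\<close>

lemma laplacian_kernel_const:
  fixes A :: "real^'n::finite^'n"
  assumes "adjacency_matrix E A" "strongly_connected E" "weight_balanced A"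
    and zero: "w \<bullet> (laplacian A *v w) = 0"
  shows "w $ i = w $ j"
proof -
  have nonneg: "A $ i $ j * (w $ i - w $ j)\<^sup>2 \<ge> 0" for i j
    using assms(1) unfolding adjacency_matrix_def by (metis less_eq_real_def mult_nonneg_nonneg zero_le_power2)
  have "(\<Sum>i\<in>UNIV. \<Sum>j\<in>UNIV. A $ i $ j * (w $ i - w $ j)\<^sup>2) = 0"
    using zero laplacian_quadratic_form[OF assms(3), of w] by simp
  then have "A $ i $ j * (w $ i - w $ j)\<^sup>2 = 0" for i j
    using nonneg by (simp add: sum_nonneg_eq_0_iff sum_nonneg)
  then have edge: "w $ i = w $ j" if "(i, j) \<in> E" for i j
    using assms(1) that unfolding adjacency_matrix_def by (metis eq_iff_diff_eq_0 less_irrefl mult_eq_0_iff power_eq_0_iff)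
  have "(i, j) \<in> E\<^sup>*"
    using assms(2) by (simp add: strongly_connected_def)
  then show ?thesis
    by induction (auto dest: edge)
qed

text \<open>The symmetric part \<open>S\<close> of the Laplacian has the same quadratic form, is positive semidefinite, and
  maps into the zero-sum vectors, on which it is definite. Its Rayleigh minimum there is therefore a
  nonzero eigenvalue, and \<open>lambda2_hat\<close>, the least of these, cannot exceed it. With a single node
  there is no nonzero zero-sum vector, hence no such eigenvalue.\<close>

lemma laplacian_coercive:
  fixes A :: "real^'n::finite^'n"
  assumes "adjacency_matrix E A" "strongly_connected E" "weight_balanced A" "CARD('n) \<noteq> 1"
  shows "lambda2_hat (laplacian A) > 0"
    and "(\<Sum>i\<in>UNIV. w $ i) = 0 \<Longrightarrow> lambda2_hat (laplacian A) * (w \<bullet> w) \<le> w \<bullet> (laplacian A *v w)"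
proof -
  let ?L = "laplacian A"
  define S where "S = (1/2) *\<^sub>R (?L + transpose ?L)"
  have sym: "transpose S = S"
    by (simp add: S_def transpose_def vec_eq_iff)
  have S_mult: "S *v x = (1/2) *\<^sub>R (?L *v x + x v* ?L)" for x
    by (simp add: S_def matrix_vector_mult_add_rdistrib scaleR_matrix_vector_assoc[symmetric])
  have quad: "x \<bullet> (S *v x) = x \<bullet> (?L *v x)" for x
    using dot_lmul_matrix[of x ?L x] by (simp add: S_mult inner_simps inner_commute)
  let ?one = "\<chi> i. 1 :: real^'n"
  have sum_eq: "(\<Sum>i\<in>UNIV. x $ i) = ?one \<bullet> x" for x :: "real^'n"
    by (simp add: inner_vec_def)
  have S_one: "S *v ?one = 0"
  proof -
    have "?L *v ?one = 0"
      by (simp add: vec_eq_iff laplacian_mult_component)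
    moreover have "(?one v* ?L) \<bullet> y = 0" for y
      using sum_laplacian_mult[OF assms(3), of y] by (simp add: dot_lmul_matrix sum_eq)
    then have "?one v* ?L = 0"
      using inner_eq_zero_iff by blast
    ultimately show ?thesis by (simp add: S_mult)
  qed
  define V where "V = {x :: real^'n. (\<Sum>i\<in>UNIV. x $ i) = 0}"
  have V: "subspace V"
    by (simp add: V_def subspace_def sum_eq inner_simps)
  have inv: "S *v x \<in> V" for x
    using S_one unfolding V_def sum_eq by (simp add: symmetric_matrix_self_adjoint[OF sym])
  have psd: "x \<bullet> (S *v x) \<ge> 0" for x
    unfolding quad laplacian_quadratic_form[OF assms(3)] using assms(1)
    by (auto intro!: sum_nonneg mult_nonneg_nonneg simp: adjacency_matrix_def)
       (metis less_eq_real_def)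
  have definite: "x = 0" if "x \<in> V" "x \<bullet> (S *v x) = 0" for x
  proof -
    have const: "x $ i = x $ j" for i j
      using laplacian_kernel_const[OF assms(1-3)] that(2) by (simp add: quad)
    have "x $ i = 0" for i
    proof -
      have "(\<Sum>j\<in>UNIV. x $ j) = (\<Sum>j\<in>(UNIV::'n set). x $ i)"
        by (intro sum.cong) (auto intro: const)
      then show ?thesis using that(1) by (simp add: V_def)
    qed
    then show ?thesis by (simp add: vec_eq_iff)
  qed
  have "\<exists>x\<in>V. x \<noteq> 0"
  proof -
    obtain a b :: 'n where "a \<noteq> b"
      using assms(4) by (metis (full_types) UNIV_I card_1_singleton_iff is_singletonI' is_singleton_altdef empty_iff)
    then have "axis a 1 - axis b 1 \<in> V" "axis a 1 - axis b (1::real) \<noteq> 0"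
      by (auto simp: V_def sum_eq inner_simps inner_axis axis_eq_axis)
    then show ?thesis by blast
  qed
  then obtain \<mu> e where e: "e \<in> V" "e \<noteq> 0" "S *v e = \<mu> *\<^sub>R e"
    and low: "\<And>x. x \<in> V \<Longrightarrow> \<mu> * (x \<bullet> x) \<le> x \<bullet> (S *v x)"
    using rayleigh_minimum_eigenvector[OF sym V inv] by metis
  let ?spec = "{\<mu>. \<mu> \<noteq> 0 \<and> real_eigenvalue S \<mu>}"
  have "\<mu> \<noteq> 0" using definite[OF e(1)] e by auto
  then have mem: "\<mu> \<in> ?spec"
    using e by (auto simp: real_eigenvalue_def scalar_mult_eq_scaleR)
  have fin: "finite ?spec"
    using finite_real_eigenvalues_symmetric[OF sym] by (rule rev_finite_subset) auto
  have lam: "lambda2_hat ?L = Min ?spec"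
    by (simp add: lambda2_hat_def S_def)
  have pos: "\<nu> > 0" if \<nu>: "\<nu> \<in> ?spec" for \<nu>
  proof -
    obtain x where x: "x \<noteq> 0" "S *v x = \<nu> *\<^sub>R x"
      using \<nu> by (auto simp: real_eigenvalue_def scalar_mult_eq_scaleR)
    then have "0 \<le> \<nu> * (x \<bullet> x)" using psd[of x] by simp
    moreover have "x \<bullet> x > 0" using x(1) by simp
    ultimately show ?thesis
      using \<nu> by (auto simp: zero_le_mult_iff)
  qed
  show "lambda2_hat ?L > 0"
    using Min_in[OF fin] mem pos unfolding lam by blast
  have "lambda2_hat ?L \<le> \<mu>"
    using Min_le[OF fin mem] by (simp add: lam)
  then show "lambda2_hat ?L * (w \<bullet> w) \<le> w \<bullet> (?L *v w)" if "(\<Sum>i\<in>UNIV. w $ i) = 0"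
    using low[of w] that mult_right_mono[of "lambda2_hat ?L" \<mu> "w \<bullet> w"]
    by (simp add: V_def quad)
qed

lemma sum_averaging_projection:
  fixes w :: "real^'n::finite"
  shows "(\<Sum>i\<in>UNIV. (averaging_projection *v w) $ i) = 0"
  by (simp add: averaging_projection_component sum_subtractf)

lemma averaging_projection_laplacian:
  fixes A :: "real^'n::finite^'n"
  assumes "weight_balanced A"
  shows "averaging_projection *v (laplacian A *v w) = laplacian A *v w"
  by (simp add: vec_eq_iff averaging_projection_component sum_laplacian_mult[OF assms])

lemma laplacian_averaging_projection:
  fixes A :: "real^'n::finite^'n"
  shows "laplacian A *v (averaging_projection *v w) = laplacian A *v w"
  by (simp add: vec_eq_iff laplacian_mult_component averaging_projection_component)

section \<open>Essentially bounded signals\<close>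

lemma ess_norm_exceptional_set:
  assumes "ess_norm f = ereal \<gamma>"
  obtains X where "negligible X" "\<And>t. t \<ge> 0 \<Longrightarrow> t \<notin> X \<Longrightarrow> norm (f t) \<le> \<gamma>"
proof -
  have "AE t in lebesgue_on {0..}. norm (f t) \<le> \<gamma>"
    using esssup_AE[of "\<lambda>t. ereal (norm (f t))" "lebesgue_on {0..}"] assms
    by (simp add: ess_norm_def)
  then have "AE t in lebesgue. t \<in> {0..} \<longrightarrow> norm (f t) \<le> \<gamma>"
    by (subst (asm) AE_restrict_space_iff) auto
  then obtain X where "X \<in> null_sets lebesgue" "{t. \<not> (t \<in> {0..} \<longrightarrow> norm (f t) \<le> \<gamma>)} \<subseteq> X"
    by (auto elim!: AE_E3 simp: eventually_ae_filter)
  then show thesis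
    by (intro that[of X]) (auto simp: negligible_iff_null_sets)
qed

lemma ess_norm_nonneg:
  assumes "ess_norm f = ereal \<gamma>"
  shows "\<gamma> \<ge> 0"
proof -
  obtain X where X: "negligible X" "\<And>t. t \<ge> 0 \<Longrightarrow> t \<notin> X \<Longrightarrow> norm (f t) \<le> \<gamma>"
    using ess_norm_exceptional_set[OF assms] by blast
  have "\<not> {0..1::real} \<subseteq> X"
    using negligible_subset[OF X(1)] negligible_interval(1)[of 0 "1::real"] by (auto simp: box_real)
  then show ?thesis
    using X(2) norm_ge_zero order_trans by (metis atLeastAtMost_iff subsetI)
qed

section \<open>Tracking error of the algorithm\<close>

text \<open>The number \<open>c\<close> is any coercivity constant of \<open>\<beta> L\<close> on the zero-sum vectors. Keeping it abstract
  treats a single node together with the general case, where \<open>c = \<beta> \<lambda>\<close>.\<close>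

lemma tracking_error_transient:
  fixes A :: "real^'n::finite^'n" and u u' z v x :: "real \<Rightarrow> real^'n"
  assumes bal: "weight_balanced A"
    and \<alpha>: "\<alpha> > 0" and c: "c > 0" and \<gamma>: "\<gamma> \<ge> 0" and low: "l > 0"
    and coercive: "\<And>w. (\<Sum>i\<in>UNIV. w $ i) = 0 \<Longrightarrow> c * (w \<bullet> w) \<le> \<beta> * (w \<bullet> (laplacian A *v w))"
    and u: "primitive u u'"
    and X: "negligible X" "\<And>t. t \<ge> 0 \<Longrightarrow> t \<notin> X \<Longrightarrow> norm (averaging_projection *v u' t) \<le> \<gamma>"
    and z: "primitive z (\<lambda>t. u' t - \<alpha> *\<^sub>R (z t - u t) - \<beta> *\<^sub>R (laplacian A *v z t) - v t)"
    and v: "primitive v (\<lambda>t. (\<alpha> * \<beta>) *\<^sub>R (laplacian A *v z t))"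
    and y: "primitive (\<lambda>t. x t $ i - z t $ i) (\<lambda>t. - \<theta> t *\<^sub>R (x t $ i - z t $ i))"
    and \<theta>: "\<And>t. t \<ge> 0 \<Longrightarrow> l \<le> \<theta> t"
    and v0: "(\<Sum>i\<in>UNIV. v 0 $ i) = 0"
  shows "\<exists>C\<ge>0. \<forall>t\<ge>0. \<bar>x t $ i - (\<Sum>j\<in>UNIV. u t $ j) / real CARD('n)\<bar>
     \<le> \<gamma> / c + C * (if \<alpha> = c \<and> \<alpha> \<le> l then 1 + t else 1) * exp (- (min l (min \<alpha> c) * t))"
proof -
  let ?L = "laplacian A" and ?\<Pi> = "averaging_projection :: real^'n^'n"
  have lin_sum: "bounded_linear (\<lambda>w :: real^'n. \<Sum>i\<in>UNIV. w $ i)"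
    by (intro bounded_linear_sum bounded_linear_vec_nth)
  have v_sum: "(\<Sum>i\<in>UNIV. v t $ i) = 0" if "t \<ge> 0" for t
    using primitive_zero_imp_const[OF _ that, of "\<lambda>t. \<Sum>i\<in>UNIV. v t $ i"] primitive_linear[OF lin_sum v] v0
    by (simp add: sum_distrib_left[symmetric] sum_laplacian_mult[OF bal])
  \<comment> \<open>The combination in which the terms in \<open>L z\<close> cancel.\<close>
  define p where "p t = \<alpha> *\<^sub>R (z t - u t) + v t" for t
  have p: "primitive p (\<lambda>t. - \<alpha> *\<^sub>R p t)"
    using primitive_add[OF primitive_scaleR[OF primitive_diff[OF z u], of \<alpha>] v]
    by (simp add: p_def[abs_def] algebra_simps)
  have p_decay: "norm (p t) \<le> norm (p 0) * exp (- (\<alpha> * t))" if "t \<ge> 0" for t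
    using damped_norm_decay[OF p _ \<alpha> that] by simp
  \<comment> \<open>Its equation involves \<open>z\<close> only through \<open>\<zeta>\<close> because \<open>\<Pi> L = L = L \<Pi>\<close>.\<close>
  define \<zeta> where "\<zeta> t = ?\<Pi> *v z t" for t
  have \<zeta>: "primitive \<zeta> (\<lambda>t. ?\<Pi> *v u' t - ?\<Pi> *v p t - \<beta> *\<^sub>R (?L *v \<zeta> t))"
    using primitive_linear[OF matrix_vector_mul_bounded_linear z, of ?\<Pi>]
    by (simp add: \<zeta>_def[abs_def] p_def laplacian_averaging_projection averaging_projection_laplacian[OF bal]
        matrix_vector_mult_diff_distrib matrix_vector_right_distrib matrix_vector_mult_scaleR algebra_simps)
  obtain D where D: "D \<ge> 0" "\<And>t. t \<ge> 0 \<Longrightarrow> norm (\<zeta> t)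
      \<le> \<gamma> / c + D * ((if \<alpha> = c then 1 + t else 1) * exp (- (min \<alpha> c * t)))"
  proof -
    let ?P = "onorm ((*v) ?\<Pi>) * norm (p 0)"
    have P: "?P \<ge> 0"
      by (intro mult_nonneg_nonneg onorm_pos_le matrix_vector_mul_bounded_linear) auto
    have bound: "norm (?\<Pi> *v u' t - ?\<Pi> *v p t - \<beta> *\<^sub>R (?L *v \<zeta> t) + \<beta> *\<^sub>R (?L *v \<zeta> t)) \<le> \<gamma> + ?P * exp (- (\<alpha> * t))"
      if "t \<ge> 0" "t \<notin> X" for t
    proof -
      have "norm (?\<Pi> *v p t) \<le> onorm ((*v) ?\<Pi>) * norm (p t)"
        by (rule onorm[OF matrix_vector_mul_bounded_linear])
      also have "\<dots> \<le> onorm ((*v) ?\<Pi>) * (norm (p 0) * exp (- (\<alpha> * t)))"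
        using p_decay[OF that(1)] by (intro mult_left_mono onorm_pos_le matrix_vector_mul_bounded_linear)
      finally show ?thesis
        using X(2)[OF that] norm_triangle_ineq4[of "?\<Pi> *v u' t" "?\<Pi> *v p t"] by (simp add: mult.assoc)
    qed
    have "bounded_linear (\<lambda>w. \<beta> *\<^sub>R (?L *v w))"
      by (intro bounded_linear_const_scaleR matrix_vector_mul_bounded_linear)
    moreover have "c * (\<zeta> t \<bullet> \<zeta> t) \<le> \<zeta> t \<bullet> (\<beta> *\<^sub>R (?L *v \<zeta> t))" for t
      using coercive[of "\<zeta> t"] by (simp add: \<zeta>_def sum_averaging_projection)
    ultimately show thesis
      using forced_norm_transient[OF \<zeta> _ X(1) bound _ c \<gamma> P] that by blast
  qed
  show ?thesis
  proof (rule transient_rate)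
    show "norm (x 0 $ i - z 0 $ i) \<ge> 0" "norm (p 0) / \<alpha> \<ge> 0" "D \<ge> 0"
      using D \<alpha> by auto
  next
    fix t :: real assume t: "t \<ge> 0"
    let ?N = "real CARD('n)"
    \<comment> \<open>As \<open>v\<close> has zero sum, \<open>p\<close> measures the deviation of the mean of \<open>z\<close> from the mean of \<open>u\<close>.\<close>
    have "\<alpha> * ((\<Sum>j\<in>UNIV. z t $ j) - (\<Sum>j\<in>UNIV. u t $ j)) = (\<Sum>j\<in>UNIV. p t $ j)"
      using v_sum[OF t] by (simp add: p_def sum.distrib sum_subtractf sum_distrib_left[symmetric])
    moreover have "\<bar>\<Sum>j\<in>UNIV. p t $ j\<bar> \<le> ?N * norm (p t)"
      using sum_bounded_above[of UNIV "\<lambda>j. \<bar>p t $ j\<bar>" "norm (p t)"]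
      by (intro order_trans[OF sum_abs]) (simp add: component_le_norm_cart)
    ultimately have "\<alpha> * \<bar>(\<Sum>j\<in>UNIV. z t $ j) - (\<Sum>j\<in>UNIV. u t $ j)\<bar> \<le> ?N * norm (p t)"
      using \<alpha> by (metis abs_mult abs_of_pos)
    also have "\<dots> \<le> ?N * (norm (p 0) * exp (- (\<alpha> * t)))"
      using p_decay[OF t] by (intro mult_left_mono) auto
    finally have mean: "\<bar>((\<Sum>j\<in>UNIV. z t $ j) - (\<Sum>j\<in>UNIV. u t $ j)) / ?N\<bar> \<le> norm (p 0) / \<alpha> * exp (- (\<alpha> * t))"
      using \<alpha> by (simp add: field_simps)
    have "x t $ i - (\<Sum>j\<in>UNIV. u t $ j) / ?N = (x t $ i - z t $ i)
        + ((\<Sum>j\<in>UNIV. z t $ j) - (\<Sum>j\<in>UNIV. u t $ j)) / ?N + \<zeta> t $ i"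
      by (simp add: \<zeta>_def averaging_projection_component diff_divide_distrib)
    then show "\<bar>x t $ i - (\<Sum>j\<in>UNIV. u t $ j) / ?N\<bar> \<le> \<gamma> / c + norm (x 0 $ i - z 0 $ i) * exp (- (l * t))
        + norm (p 0) / \<alpha> * exp (- (\<alpha> * t)) + D * ((if \<alpha> = c then 1 + t else 1) * exp (- (min \<alpha> c * t)))"
      using mean D(2)[OF t] component_le_norm_cart[of "\<zeta> t" i]
        damped_norm_decay[OF y \<theta> low t, unfolded real_norm_def]
      unfolding real_norm_def by linarith
  qed
qed

theorem lemma5p1:
  fixes E :: "('n::finite \<times> 'n) set"
    and A L :: "real^'n^'n"
    and u u' z v x :: "real \<Rightarrow> real^'n"
    and \<theta> :: "'n \<Rightarrow> real \<Rightarrow> real"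
    and \<theta>_low \<theta>_up :: "'n \<Rightarrow> real"
    and \<alpha> \<beta> \<gamma> :: real
  assumes "adjacency_matrix E A"
    and "strongly_connected E"
    and "weight_balanced A"
    and "L = laplacian A"
    and "\<alpha> > 0" and "\<beta> > 0"
    and "\<And>i. (\<lambda>t. u t $ i) has_time_derivative (\<lambda>t. u' t $ i)"
    and "ess_norm (\<lambda>t. averaging_projection *v u' t) = ereal \<gamma>"
    and "\<And>i. 0 < \<theta>_low i"
    and "\<And>i t. t \<ge> 0 \<Longrightarrow> \<theta>_low i \<le> \<theta> i t \<and> \<theta> i t \<le> \<theta>_up i"
    and "\<And>i. (\<lambda>t. z t $ i) has_time_derivative
            (\<lambda>t. u' t $ i - \<alpha> * (z t $ i - u t $ i)
                 - \<beta> * (\<Sum>j\<in>UNIV. L $ i $ j * z t $ j) - v t $ i)"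
    and "\<And>i. (\<lambda>t. v t $ i) has_time_derivative
            (\<lambda>t. \<alpha> * \<beta> * (\<Sum>j\<in>UNIV. L $ i $ j * z t $ j))"
    and "\<And>i. (\<lambda>t. x t $ i) has_time_derivative
            (\<lambda>t. - \<theta> i t * (x t $ i - z t $ i) + u' t $ i - \<alpha> * (z t $ i - u t $ i)
                 - \<beta> * (\<Sum>j\<in>UNIV. L $ i $ j * z t $ j) - v t $ i)"
    and "(\<Sum>i\<in>UNIV. v 0 $ i) = 0"
  shows "\<forall>i.
     Limsup at_top
       (\<lambda>t. ereal \<bar>x t $ i - (1 / real CARD('n)) * (\<Sum>j\<in>UNIV. u t $ j)\<bar>)
       \<le> ereal (inverse (\<beta> * lambda2_hat L) * \<gamma>)
   \<and> (\<exists>C. \<forall>t\<ge>0.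
        \<bar>x t $ i - (1 / real CARD('n)) * (\<Sum>j\<in>UNIV. u t $ j)\<bar>
        \<le> inverse (\<beta> * lambda2_hat L) * \<gamma>
          + C * (if \<alpha> = \<beta> * lambda2_hat L \<and> \<alpha> \<le> \<theta>_low i then 1 + t else 1)
              * exp (- (min (\<theta>_low i) (min \<alpha> (\<beta> * lambda2_hat L)) * t)))"
proof
  fix i
  let ?l2 = "lambda2_hat L" and ?N = "real CARD('n)"
  let ?err = "\<lambda>t. \<bar>x t $ i - (1 / ?N) * (\<Sum>j\<in>UNIV. u t $ j)\<bar>"
  have L: "L = laplacian A" by fact
  have \<gamma>: "\<gamma> \<ge> 0" using ess_norm_nonneg[OF assms(8)] .
  obtain X where X: "negligible X" "\<And>t. t \<ge> 0 \<Longrightarrow> t \<notin> X \<Longrightarrow> norm (averaging_projection *v u' t) \<le> \<gamma>"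
    using ess_norm_exceptional_set[OF assms(8)] by blast
  have u: "primitive u u'"
    using assms(7) by (simp add: primitive_componentwise)
  have z: "primitive z (\<lambda>t. u' t - \<alpha> *\<^sub>R (z t - u t) - \<beta> *\<^sub>R (laplacian A *v z t) - v t)"
    using assms(11) by (simp add: primitive_componentwise matrix_vector_mult_def L)
  have v: "primitive v (\<lambda>t. (\<alpha> * \<beta>) *\<^sub>R (laplacian A *v z t))"
    using assms(12) by (simp add: primitive_componentwise matrix_vector_mult_def L)
  have y: "primitive (\<lambda>t. x t $ i - z t $ i) (\<lambda>t. - \<theta> i t *\<^sub>R (x t $ i - z t $ i))"
    using primitive_diff[OF assms(13)[of i, unfolded has_time_derivative_iff_primitive]
        assms(11)[of i, unfolded has_time_derivative_iff_primitive]]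
    by (simp add: algebra_simps)
  \<comment> \<open>\<open>c = \<beta> \<lambda>\<close> when there are several nodes; the last two properties transfer rate and resonance.\<close>
  obtain c where c: "c > 0" and M: "\<gamma> / c = inverse (\<beta> * ?l2) * \<gamma>"
    and coercive: "\<And>w. (\<Sum>i\<in>UNIV. w $ i) = 0 \<Longrightarrow> c * (w \<bullet> w) \<le> \<beta> * (w \<bullet> (laplacian A *v w))"
    and rate: "min \<alpha> (\<beta> * ?l2) \<le> min \<alpha> c" and res: "\<alpha> = c \<Longrightarrow> \<alpha> = \<beta> * ?l2"
  proof (cases "CARD('n) = 1")
    case True
    have single: "w = 0" if "(\<Sum>i\<in>UNIV. w $ i) = 0" for w :: "real^'n"
    proof -
      obtain a where a: "(UNIV :: 'n set) = {a}"
        using True by (rule card_1_singletonE)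
      have "w $ k = 0" for k
        using that UNIV_I[of k] unfolding a by simp
      then show ?thesis by (simp add: vec_eq_iff)
    qed
    have "averaging_projection *v w = 0" for w :: "real^'n"
      using single sum_averaging_projection by blast
    then have "ess_norm (\<lambda>t. averaging_projection *v u' t) \<le> ereal 0"
      unfolding ess_norm_def by (intro esssup_I) auto
    then have "\<gamma> = 0" using \<gamma> assms(8) by simp
    \<comment> \<open>Every constant is coercive on the zero space; one above \<open>\<alpha>\<close> costs no rate and avoids resonance.\<close>
    then show thesis
      using that[of "\<alpha> + 1"] \<open>\<alpha> > 0\<close> single by fastforce
  next
    case False
    note co = laplacian_coercive[OF assms(1-3) False]
    show thesis
    proof (rule that[of "\<beta> * ?l2"])
      show "\<beta> * ?l2 * (w \<bullet> w) \<le> \<beta> * (w \<bullet> (laplacian A *v w))" if "(\<Sum>i\<in>UNIV. w $ i) = 0" for w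
        using mult_left_mono[OF co(2)[OF that], of \<beta>] \<open>\<beta> > 0\<close> by (simp add: L mult.assoc)
    qed (use co(1) \<open>\<beta> > 0\<close> in \<open>auto simp: L divide_inverse mult.commute\<close>)
  qed
  have "\<And>t. t \<ge> 0 \<Longrightarrow> \<theta>_low i \<le> \<theta> i t"
    using assms(10) by blast
  from tracking_error_transient[OF assms(3) \<open>\<alpha> > 0\<close> c \<gamma> assms(9)[of i] coercive u X z v y this assms(14)]
  obtain C where C: "C \<ge> 0" and err: "\<And>t. t \<ge> 0 \<Longrightarrow> ?err t \<le> inverse (\<beta> * ?l2) * \<gamma>
      + C * (if \<alpha> = c \<and> \<alpha> \<le> \<theta>_low i then 1 + t else 1) * exp (- (min (\<theta>_low i) (min \<alpha> c) * t))"
    unfolding M by auto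
  have "Limsup at_top (\<lambda>t. ereal (?err t)) \<le> ereal (inverse (\<beta> * ?l2) * \<gamma>)"
    using Limsup_le_of_transient[OF _ C err] assms(5,9) c by simp
  moreover have "?err t \<le> inverse (\<beta> * ?l2) * \<gamma>
      + C * (if \<alpha> = \<beta> * ?l2 \<and> \<alpha> \<le> \<theta>_low i then 1 + t else 1) * exp (- (min (\<theta>_low i) (min \<alpha> (\<beta> * ?l2)) * t))"
    if t: "t \<ge> 0" for t
  proof -
    have "min (\<theta>_low i) (min \<alpha> (\<beta> * ?l2)) \<le> min (\<theta>_low i) (min \<alpha> c)"
      using rate by (rule min.mono[OF order_refl])
    then have "exp (- (min (\<theta>_low i) (min \<alpha> c) * t)) \<le> exp (- (min (\<theta>_low i) (min \<alpha> (\<beta> * ?l2)) * t))"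
      using t by (simp only: exp_le_cancel_iff neg_le_iff_le mult_right_mono)
    moreover have "(if \<alpha> = c \<and> \<alpha> \<le> \<theta>_low i then 1 + t else 1) \<le> (if \<alpha> = \<beta> * ?l2 \<and> \<alpha> \<le> \<theta>_low i then 1 + t else 1)"
      using res t by auto
    ultimately have "C * (if \<alpha> = c \<and> \<alpha> \<le> \<theta>_low i then 1 + t else 1) * exp (- (min (\<theta>_low i) (min \<alpha> c) * t))
      \<le> C * (if \<alpha> = \<beta> * ?l2 \<and> \<alpha> \<le> \<theta>_low i then 1 + t else 1) * exp (- (min (\<theta>_low i) (min \<alpha> (\<beta> * ?l2)) * t))"
      using C t by (intro mult_mono mult_left_mono) auto
    with err[OF t] show ?thesis by linarith
  qed
  ultimately show "Limsup at_top (\<lambda>t. ereal (?err t)) \<le> ereal (inverse (\<beta> * ?l2) * \<gamma>)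
     \<and> (\<exists>C. \<forall>t\<ge>0. ?err t \<le> inverse (\<beta> * ?l2) * \<gamma>
          + C * (if \<alpha> = \<beta> * ?l2 \<and> \<alpha> \<le> \<theta>_low i then 1 + t else 1)
              * exp (- (min (\<theta>_low i) (min \<alpha> (\<beta> * ?l2)) * t)))"
    by blast
qed

end
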